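(* Let $\mathcal{A}$ be an associative algebra over $\mathbb{R}$ with unit element $e_0 = 1$, and let $e_1, e_2, e_3 \in \mathcal{A}$ satisfy postulates (a) and (b) with $k_1 = k_2 = k_3 = 1$, that is, $e_1^2 = e_2^2 = e_3^2 = 1$ and $e_1e_2 = -e_2e_1$, $e_2e_3 = -e_3e_2$, $e_3e_1 = -e_1e_3$. Put $i = e_1e_2e_3$. Then $$e_1e_2 = -e_2e_1 = i e_3, \qquad e_2e_3 = -e_3e_2 = i e_1, \qquad e_3e_1 = -e_1e_3 = i e_2 .$$
   Context: Postulates on three abstract basic elements $e_1,e_2,e_3$ of an associative algebra with unit $e_0=1$ (so $e_0e_j=e_je_0$): (a) each has a scalar square, $e_je_j = k_j$ with $k_j\in\mathbb{R}$ (identified with $k_j e_0$); (b) they pairwise anticommute, $e_1e_2=-e_2e_1$, $e_2e_3=-e_3e_2$, $e_3e_1=-e_1e_3$. The symbol $i$ denotes the algebra element $e_1e_2e_3$, not a scalar. *)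

theory Defs imports Complex_Main begin

end

theory Submission imports Defs begin

text \<open>In \<open>i * ej\<close>, the last factor moves left to its twin, with one sign for each
  generator crossed, and the resulting square is 1. The number of crossings is 0 for
  \<open>e3\<close>, 2 for \<open>e1\<close> and 1 for \<open>e2\<close>; the one surviving sign
  gives \<open>- (e1 * e3)\<close>.\<close>

theorem theoremn1:
  fixes e1 e2 e3 i :: "'a :: {real_algebra, monoid_mult}"
  assumes "e1 * e1 = 1" and "e2 * e2 = 1" and "e3 * e3 = 1"
    and "e1 * e2 = - (e2 * e1)"
    and "e2 * e3 = - (e3 * e2)"
    and "e3 * e1 = - (e1 * e3)"
    and "i = e1 * e2 * e3"
  shows "(e1 * e2 = - (e2 * e1) \<and> - (e2 * e1) = i * e3) \<and>
         (e2 * e3 = - (e3 * e2) \<and> - (e3 * e2) = i * e1) \<and>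
         (e3 * e1 = - (e1 * e3) \<and> - (e1 * e3) = i * e2)"
proof -
  have "i * e3 = e1 * e2 * (e3 * e3)"
    using assms(7) by (simp add: mult.assoc)
  then have i3: "i * e3 = e1 * e2"
    using assms(3) by simp
  have "i * e1 = e1 * e2 * (e3 * e1)"
    using assms(7) by (simp add: mult.assoc)
  \<comment> \<open>The sign from \<open>e1\<close> crossing \<open>e3\<close> is parked on
    \<open>e2 * e1\<close>, where the next crossing absorbs it.\<close>
  also have "\<dots> = e1 * (- (e2 * e1)) * e3"
    unfolding assms(6) by (simp add: mult.assoc)
  also have "\<dots> = e1 * e1 * e2 * e3"
    unfolding assms(4)[symmetric] by (simp add: mult.assoc)
  finally have i1: "i * e1 = e2 * e3"
    using assms(1) by simp
  \<comment> \<open>The double negation exposes \<open>- (e3 * e2)\<close>, to be replaced by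
    \<open>e2 * e3\<close>; the outer sign stays.\<close>
  have "i * e2 = e1 * e2 * (- (- (e3 * e2)))"
    using assms(7) by (simp add: mult.assoc)
  also have "\<dots> = - (e1 * (e2 * e2) * e3)"
    unfolding assms(5)[symmetric] by (simp add: mult.assoc)
  finally have i2: "i * e2 = - (e1 * e3)"
    using assms(2) by simp
  show ?thesis
    using i1 i2 i3 assms(4-6) by simp
qed

end
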